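(* Let $(X,\mathcal{U})$ be a Hausdorff uniform space, let $E$ be a topological space and let $T:E\to\mathcal{K}(X)$ be a multi-function. Then $T$ is both lower semi-continuous and upper semi-continuous if and only if $T$ is continuous with respect to the induced $\mathcal{H}$-topology on $\mathcal{K}(X)$.
   Context: For $x\in X$, $A\subseteq X$, $U\in\mathcal{U}$: $U[x]=\{y\in X:(x,y)\in U\}$ and $U[A]=\bigcup_{x\in A}U[x]$. $X$ carries the topology induced by $\mathcal{U}$. A set $B\subseteq X$ is bounded if $B\subseteq U[x]$ for some $x\in X$, $U\in\mathcal{U}$. $\mathcal{C}(X)$ is the family of closed nonempty subsets of $X$, $\mathcal{CB}(X)$ the family of closed, bounded, nonempty subsets, and $\mathcal{K}(X)\subseteq\mathcal{CB}(X)$ the family of nonempty compact subsets. The $\mathcal{H}$-topology on $\mathcal{CB}(X)$ is the topology of the uniformity having as fundamental system of entourages the sets $H_U=\{(A,B)\in\mathcal{CB}(X)\times\mathcal{CB}(X): A\subseteq U[B],\ B\subseteq U[A]\}$, $U\in\mathcal{U}$; $\mathcal{K}(X)$ carries the induced topology. For $T:E\to\mathcal{C}(X)$ and $B\subseteq X$, $T^{-1}(B)=\{x\in E: Tx\cap B\neq\emptyset\}$. $T$ is lower semi-continuous if $T^{-1}(G)$ is open in $E$ for every open $G\subseteq X$, and upper semi-continuous if $T^{-1}(F)$ is closed in $E$ for every closed $F\subseteq X$. *)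

theory Defs
  imports "HOL-Analysis.Abstract_Topology" "HOL-Library.FuncSet"
begin

text \<open>
  The neighbourhood \<open>U[x]\<close> is the relational image \<open>U `` {x}\<close>, and \<open>U[A]\<close> is \<open>U `` A\<close>.
\<close>

definition entourages :: "('a::uniform_space \<times> 'a) set set" where
  "entourages = {U. eventually (\<lambda>p. p \<in> U) uniformity}"

text \<open>
  All entourages are allowed below, including the full relation; this is the uniform notion
  of boundedness taken literally, and not the metric \<open>bounded\<close>.
\<close>

definition uniformly_bounded :: "'a::uniform_space set \<Rightarrow> bool" where
  "uniformly_bounded B \<longleftrightarrow> (\<exists>x. \<exists>U\<in>entourages. B \<subseteq> U `` {x})"

definition CB_sets :: "'a::uniform_space set set" where
  "CB_sets = {A. closed A \<and> uniformly_bounded A \<and> A \<noteq> {}}"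

definition K_sets :: "'a::topological_space set set" where
  "K_sets = {A. compact A \<and> A \<noteq> {}}"

definition H_entourage ::
    "('a::uniform_space \<times> 'a) set \<Rightarrow> ('a set \<times> 'a set) set" where
  "H_entourage U = {(A, B) \<in> CB_sets \<times> CB_sets. A \<subseteq> U `` B \<and> B \<subseteq> U `` A}"

definition H_uniformity :: "('a::uniform_space set \<times> 'a set) set set" where
  "H_uniformity = {W. W \<subseteq> CB_sets \<times> CB_sets \<and> (\<exists>U\<in>entourages. H_entourage U \<subseteq> W)}"

definition H_topology :: "'a::uniform_space set topology" where
  "H_topology =
     topology (\<lambda>G. G \<subseteq> CB_sets \<and> (\<forall>A\<in>G. \<exists>W\<in>H_uniformity. W `` {A} \<subseteq> G))"

lemma UNIV_in_entourages: "UNIV \<in> entourages"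
  by (simp add: entourages_def)

lemma Int_in_entourages:
  "U \<in> entourages \<Longrightarrow> V \<in> entourages \<Longrightarrow> U \<inter> V \<in> entourages"
  by (simp add: entourages_def eventually_conj)

lemma CB_sets_square_in_H_uniformity: "CB_sets \<times> CB_sets \<in> H_uniformity"
  using UNIV_in_entourages by (auto simp: H_uniformity_def H_entourage_def)

lemma Int_in_H_uniformity:
  assumes "V \<in> H_uniformity" "W \<in> H_uniformity"
  shows "V \<inter> W \<in> H_uniformity"
proof -
  obtain U1 U2 where "U1 \<in> entourages" "H_entourage U1 \<subseteq> V"
    and "U2 \<in> entourages" "H_entourage U2 \<subseteq> W"
    using assms by (auto simp: H_uniformity_def)
  moreover have "H_entourage (U1 \<inter> U2) \<subseteq> H_entourage U1 \<inter> H_entourage U2"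
    unfolding H_entourage_def by blast
  ultimately have "U1 \<inter> U2 \<in> entourages" "H_entourage (U1 \<inter> U2) \<subseteq> V \<inter> W"
    using Int_in_entourages[of U1 U2] by auto
  then show ?thesis
    using assms by (auto simp: H_uniformity_def)
qed

lemma openin_H_topology:
  "openin H_topology G \<longleftrightarrow>
     G \<subseteq> CB_sets \<and> (\<forall>A\<in>G. \<exists>W\<in>H_uniformity. W `` {A} \<subseteq> G)"
proof -
  have "istopology (\<lambda>G. G \<subseteq> CB_sets \<and>
          (\<forall>A\<in>G. \<exists>W\<in>H_uniformity. W `` {A} \<subseteq> (G :: 'a set set)))"
    (is "istopology ?P")
    unfolding istopology_def
  proof (intro conjI allI impI)
    fix S T :: "'a set set"
    assume S: "?P S" and T: "?P T"
    then show "S \<inter> T \<subseteq> CB_sets" by blast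
    show "\<forall>A\<in>S \<inter> T. \<exists>W\<in>H_uniformity. W `` {A} \<subseteq> S \<inter> T"
    proof
      fix A assume "A \<in> S \<inter> T"
      with S T obtain V W where "V \<in> H_uniformity" "V `` {A} \<subseteq> S"
        and "W \<in> H_uniformity" "W `` {A} \<subseteq> T"
        by blast
      then show "\<exists>W\<in>H_uniformity. W `` {A} \<subseteq> S \<inter> T"
        by (intro bexI[OF _ Int_in_H_uniformity[of V W]]) auto
    qed
  next
    fix \<K> :: "'a set set set"
    assume \<K>: "\<forall>K\<in>\<K>. ?P K"
    then show "\<Union>\<K> \<subseteq> CB_sets" by blast
    show "\<forall>A\<in>\<Union>\<K>. \<exists>W\<in>H_uniformity. W `` {A} \<subseteq> \<Union>\<K>"
    proof
      fix A assume "A \<in> \<Union>\<K>"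
      then obtain K where "K \<in> \<K>" "A \<in> K" by blast
      with \<K> obtain W where "W \<in> H_uniformity" "W `` {A} \<subseteq> K" by blast
      with \<open>K \<in> \<K>\<close> show "\<exists>W\<in>H_uniformity. W `` {A} \<subseteq> \<Union>\<K>" by blast
    qed
  qed
  then show ?thesis
    by (simp add: H_topology_def)
qed

lemma topspace_H_topology: "topspace H_topology = CB_sets"
proof
  show "topspace H_topology \<subseteq> CB_sets"
    using openin_H_topology[of "topspace H_topology"] openin_topspace[of H_topology] by metis
  have "openin H_topology CB_sets"
    unfolding openin_H_topology
    by (auto intro!: bexI[OF _ CB_sets_square_in_H_uniformity])
  then show "CB_sets \<subseteq> topspace H_topology"
    by (rule openin_subset)
qed

lemma K_sets_subset_CB_sets:
  "(K_sets :: 'a::{uniform_space, t2_space} set set) \<subseteq> CB_sets"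
  using UNIV_in_entourages
  by (auto simp: K_sets_def CB_sets_def uniformly_bounded_def compact_imp_closed)

definition multi_preimage :: "'e topology \<Rightarrow> ('e \<Rightarrow> 'a set) \<Rightarrow> 'a set \<Rightarrow> 'e set" where
  "multi_preimage E T B = {x \<in> topspace E. T x \<inter> B \<noteq> {}}"

definition lower_semicontinuous_multi ::
    "'e topology \<Rightarrow> ('e \<Rightarrow> 'a::topological_space set) \<Rightarrow> bool" where
  "lower_semicontinuous_multi E T \<longleftrightarrow> (\<forall>G. open G \<longrightarrow> openin E (multi_preimage E T G))"

definition upper_semicontinuous_multi ::
    "'e topology \<Rightarrow> ('e \<Rightarrow> 'a::topological_space set) \<Rightarrow> bool" where
  "upper_semicontinuous_multi E T \<longleftrightarrow> (\<forall>F. closed F \<longrightarrow> closedin E (multi_preimage E T F))"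

end

(* Both notions of continuity are tested on the "hit" sets {B. B meets G} and the "miss" sets
   {B. B \<subseteq> G} with G open.  A compact set lies uniformly inside each of its open neighbourhoods
   and is covered by finitely many V-small neighbourhoods, so near a compact set these sets
   describe exactly the H-neighbourhoods. *)
theory Submission
  imports Defs "HOL-Analysis.Elementary_Topology"
begin

text \<open>The triangle axiom of the filter \<open>uniformity\<close>, moved from predicates to
  sets; \<open>V\<close> plays the part of \<epsilon>/2.\<close>

lemma entourages_comp:
  assumes "U \<in> entourages"
  obtains V where "V \<in> entourages" "V O V \<subseteq> U"
proof -
  obtain D where "eventually D uniformity"
    and "\<And>x y z. D (x, y) \<Longrightarrow> D (y, z) \<Longrightarrow> (x, z) \<in> U"
    using uniformity_transE[of "\<lambda>p. p \<in> U"] assms by (auto simp: entourages_def)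
  then have "Collect D \<in> entourages" "Collect D O Collect D \<subseteq> U"
    by (auto simp: entourages_def)
  then show thesis by (rule that)
qed

lemma entourages_converse: "U \<in> entourages \<Longrightarrow> U\<inverse> \<in> entourages"
  using uniformity_sym[of "\<lambda>p. p \<in> U"]
  by (auto simp: entourages_def case_prod_beta elim: eventually_mono)

lemma entourages_refl: "U \<in> entourages \<Longrightarrow> (x, x) \<in> U"
  using uniformity_refl[of "\<lambda>p. p \<in> U"] by (simp add: entourages_def)

lemma entourages_Inter:
  "finite F \<Longrightarrow> (\<And>a. a \<in> F \<Longrightarrow> V a \<in> entourages) \<Longrightarrow> (\<Inter>a\<in>F. V a) \<in> entourages"
  by (induction F rule: finite_induct) (auto intro: UNIV_in_entourages Int_in_entourages)

lemma open_entourageE: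
  assumes "open G" "a \<in> G"
  obtains U where "U \<in> entourages" "U `` {a} \<subseteq> G"
proof -
  \<comment> \<open>Only pairs starting at \<open>a\<close> are constrained; that this relation is
    an entourage is openness of \<open>G\<close> at \<open>a\<close> in the sense of
    \<open>open_uniformity\<close>.\<close>
  have "{(x, y). x = a \<longrightarrow> y \<in> G} \<in> entourages"
    using assms by (simp add: entourages_def open_uniformity)
  then show thesis by (rule that) auto
qed

text \<open>\<open>U[a]\<close> is a neighbourhood of \<open>a\<close> but need not be open; passing
  to interiors supplies the open sets that covers and semicontinuity ask for.\<close>

lemma entourage_interior:
  assumes "U \<in> entourages"
  shows "a \<in> interior (U `` {a})"
proof -
  have "eventually (\<lambda>y. y \<in> U `` {a}) (nhds a)"
    using assms unfolding eventually_nhds_uniformity entourages_def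
    by (auto elim: eventually_mono)
  then show ?thesis
    by (auto simp: eventually_nhds interior_def)
qed

lemma compact_finite_entourage_cover:
  assumes "compact K" and "\<And>a. a \<in> K \<Longrightarrow> V a \<in> entourages"
  obtains F where "finite F" "F \<subseteq> K" "K \<subseteq> (\<Union>a\<in>F. interior (V a `` {a}))"
proof -
  have "K \<subseteq> (\<Union>a\<in>K. interior (V a `` {a}))"
    using entourage_interior assms(2) by blast
  then show thesis
    by (rule compactE_image[OF assms(1) open_interior]) (rule that)
qed

text \<open>A Lebesgue number argument: choose a half-size entourage at each point of
  \<open>K\<close>, keep finitely many by compactness, and intersect them.\<close>

lemma compact_subset_open_entourageE:
  assumes "compact K" "open G" "K \<subseteq> G"
  obtains U where "U \<in> entourages" "U `` K \<subseteq> G"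
proof -
  have "\<exists>V\<in>entourages. (V O V) `` {a} \<subseteq> G" if a: "a \<in> K" for a
  proof -
    obtain U where "U \<in> entourages" "U `` {a} \<subseteq> G"
      using open_entourageE assms a by blast
    moreover obtain V where "V \<in> entourages" "V O V \<subseteq> U"
      using entourages_comp calculation(1) by blast
    ultimately show ?thesis by blast
  qed
  then obtain V where V: "\<And>a. a \<in> K \<Longrightarrow> V a \<in> entourages"
    and VV: "\<And>a. a \<in> K \<Longrightarrow> (V a O V a) `` {a} \<subseteq> G"
    by metis
  obtain F where F: "finite F" "F \<subseteq> K" and cover: "K \<subseteq> (\<Union>a\<in>F. interior (V a `` {a}))"
    using compact_finite_entourage_cover[OF assms(1), of V] V by blast
  have "(\<Inter>a\<in>F. V a) \<in> entourages"
    using F V by (intro entourages_Inter) auto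
  moreover have "(\<Inter>a\<in>F. V a) `` K \<subseteq> G"
  proof
    fix y assume "y \<in> (\<Inter>a\<in>F. V a) `` K"
    then obtain x where x: "x \<in> K" "(x, y) \<in> (\<Inter>a\<in>F. V a)" by blast
    with cover obtain a where "a \<in> F" "x \<in> V a `` {a}"
      using interior_subset by blast
    \<comment> \<open>The pairs \<open>(a, x)\<close> and \<open>(x, y)\<close> both lie in
      \<open>V a\<close>, so \<open>y\<close> is within the doubled entourage at
      \<open>a\<close>.\<close>
    with x F VV[of a] show "y \<in> G" by blast
  qed
  ultimately show thesis by (rule that)
qed

lemma H_entourage_in_H_uniformity: "U \<in> entourages \<Longrightarrow> H_entourage U \<in> H_uniformity"
  by (auto simp: H_uniformity_def H_entourage_def)

text \<open>The sets \<open>H_entourage U\<close> form a base of \<open>H_uniformity\<close>, so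
  openness can be tested on them alone, here and in the elimination rule below.\<close>

lemma openin_H_topologyI:
  assumes "\<G> \<subseteq> CB_sets"
    and "\<And>A. A \<in> \<G> \<Longrightarrow> \<exists>U\<in>entourages. H_entourage U `` {A} \<subseteq> \<G>"
  shows "openin H_topology \<G>"
  unfolding openin_H_topology using assms H_entourage_in_H_uniformity by blast

lemma openin_H_topologyE:
  assumes "openin H_topology \<G>" "A \<in> \<G>"
  obtains U where "U \<in> entourages" "H_entourage U `` {A} \<subseteq> \<G>"
  using assms unfolding openin_H_topology H_uniformity_def by blast

lemma openin_H_topology_hit:
  assumes "open G"
  shows "openin H_topology {B \<in> CB_sets. B \<inter> G \<noteq> {}}"
proof (rule openin_H_topologyI)
  fix A assume "A \<in> {B \<in> CB_sets. B \<inter> G \<noteq> {}}"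
  then obtain a where a: "a \<in> A" "a \<in> G" by blast
  obtain U where "U \<in> entourages" "U `` {a} \<subseteq> G"
    using open_entourageE assms a by blast
  \<comment> \<open>The inclusion yields \<open>b\<close> in \<open>B\<close> with
    \<open>(b, a)\<close> in the converse of \<open>U\<close>; the converse turns this into
    \<open>b\<close> in \<open>U[a]\<close>, hence in \<open>G\<close>.\<close>
  moreover have "B \<inter> G \<noteq> {}" if "A \<subseteq> U\<inverse> `` B" for B
    using that a(1) calculation(2) by blast
  ultimately show "\<exists>U\<in>entourages. H_entourage U `` {A} \<subseteq> {B \<in> CB_sets. B \<inter> G \<noteq> {}}"
    by (intro bexI[OF _ entourages_converse[of U]]) (auto simp: H_entourage_def)
qed blast

text \<open>For noncompact \<open>B\<close> the condition \<open>B \<subseteq> G\<close> alone need not define an open set.\<close>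

lemma openin_H_topology_miss:
  "openin H_topology {B \<in> CB_sets. \<exists>U\<in>entourages. U `` B \<subseteq> G}"
proof (rule openin_H_topologyI)
  fix A assume "A \<in> {B \<in> CB_sets. \<exists>U\<in>entourages. U `` B \<subseteq> G}"
  then obtain U where U: "U \<in> entourages" "U `` A \<subseteq> G" by blast
  obtain V where V: "V \<in> entourages" "V O V \<subseteq> U"
    using entourages_comp U(1) by blast
  \<comment> \<open>One half of \<open>U\<close> pays for the distance from \<open>A\<close> to
    \<open>B\<close>, the other is the margin that \<open>B\<close> keeps inside
    \<open>G\<close>.\<close>
  have "V `` B \<subseteq> G" if "B \<subseteq> V `` A" for B
    using that V(2) U(2) by blast
  with V(1) show "\<exists>V\<in>entourages. H_entourage V `` {A}
      \<subseteq> {B \<in> CB_sets. \<exists>U\<in>entourages. U `` B \<subseteq> G}"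
    by (intro bexI[OF _ V(1)]) (auto simp: H_entourage_def)
qed blast

text \<open>By complements: \<open>T x\<close> misses \<open>F\<close> exactly when it lies in the
  open set \<open>- F\<close>.\<close>

lemma upper_semicontinuous_multi_iff_open:
  "upper_semicontinuous_multi E T \<longleftrightarrow> (\<forall>G. open G \<longrightarrow> openin E {x \<in> topspace E. T x \<subseteq> G})"
proof -
  have eq: "topspace E - multi_preimage E T F = {x \<in> topspace E. T x \<subseteq> - F}" for F
    by (auto simp: multi_preimage_def)
  have "closedin E (multi_preimage E T F) \<longleftrightarrow> openin E {x \<in> topspace E. T x \<subseteq> - F}" for F
    unfolding closedin_def eq by (auto simp: multi_preimage_def)
  then show ?thesis
    unfolding upper_semicontinuous_multi_def
    by (metis closed_Compl double_complement open_Compl)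
qed

text \<open>Upper semicontinuity keeps \<open>T y\<close> inside the neighbourhood
  \<open>U[T x]\<close> of \<open>T x\<close>. For the reverse inclusion, compactness reduces
  \<open>T x\<close> to finitely many small sets, and lower semicontinuity makes \<open>T y\<close>
  hit each of them.\<close>

lemma semicontinuous_imp_H_near:
  assumes lsc: "lower_semicontinuous_multi E T" and usc: "upper_semicontinuous_multi E T"
    and x: "x \<in> topspace E" and K: "compact (T x)" and U: "U \<in> entourages"
  obtains N where "openin E N" "x \<in> N"
    "\<And>y. y \<in> N \<Longrightarrow> T x \<subseteq> U `` T y \<and> T y \<subseteq> U `` T x"
proof -
  obtain V0 where V0: "V0 \<in> entourages" "V0 O V0 \<subseteq> U"
    using entourages_comp U by blast
  \<comment> \<open>Symmetrised so that two points of the same \<open>V[a]\<close> are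
    \<open>U\<close>-close, going from one to the other through \<open>a\<close>.\<close>
  define V where "V = V0 \<inter> V0\<inverse>"
  have V: "V \<in> entourages"
    unfolding V_def using V0 by (intro Int_in_entourages entourages_converse)
  have swap: "(b, c) \<in> U" if "(a, b) \<in> V" "(a, c) \<in> V" for a b c
    using that V0(2) unfolding V_def by blast
  obtain F where F: "finite F" "F \<subseteq> T x" and cover: "T x \<subseteq> (\<Union>a\<in>F. interior (V `` {a}))"
    using compact_finite_entourage_cover[OF K, of "\<lambda>_. V"] V by blast
  \<comment> \<open>The factor \<open>topspace E\<close> keeps \<open>N1\<close> open also when
    \<open>F\<close> is empty, where the indexed intersection is \<open>UNIV\<close>.\<close>
  define N1 where
    "N1 = topspace E \<inter> (\<Inter>a\<in>F. multi_preimage E T (interior (V `` {a})))"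
  define N2 where "N2 = {y \<in> topspace E. T y \<subseteq> interior (U `` T x)}"
  have "openin E (multi_preimage E T (interior (V `` {a})))" for a
    using lsc by (simp add: lower_semicontinuous_multi_def)
  then have "openin E N1"
    unfolding N1_def using F(1) by (cases "F = {}") (auto intro!: openin_Int openin_INT)
  moreover have "openin E N2"
    using usc by (simp add: upper_semicontinuous_multi_iff_open N2_def)
  ultimately have "openin E (N1 \<inter> N2)" by (rule openin_Int)
  moreover have "x \<in> N1 \<inter> N2"
  proof
    show "x \<in> N1"
      using x F(2) entourage_interior[OF V] by (auto simp: N1_def multi_preimage_def)
    have "interior (U `` {a}) \<subseteq> interior (U `` T x)" if "a \<in> T x" for a
      using that by (intro interior_mono) blast
    then show "x \<in> N2"
      using x entourage_interior[OF U] by (auto simp: N2_def)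
  qed
  moreover have "T x \<subseteq> U `` T y \<and> T y \<subseteq> U `` T x" if y: "y \<in> N1 \<inter> N2" for y
  proof
    show "T y \<subseteq> U `` T x"
      using y interior_subset unfolding N2_def by blast
    show "T x \<subseteq> U `` T y"
    proof
      fix c assume "c \<in> T x"
      with cover obtain a where a: "a \<in> F" "(a, c) \<in> V"
        using interior_subset by blast
      \<comment> \<open>\<open>T y\<close> hits the same small set that contains \<open>c\<close>;
        the point \<open>b\<close> where it does so is \<open>U\<close>-close to
        \<open>c\<close>.\<close>
      with y have "T y \<inter> interior (V `` {a}) \<noteq> {}"
        by (auto simp: N1_def multi_preimage_def)
      then obtain b where "b \<in> T y" "(a, b) \<in> V"
        using interior_subset by blast
      with a(2) show "c \<in> U `` T y" using swap by blast
    qed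
  qed
  ultimately show thesis by (rule that)
qed

theorem theorem2:
  fixes E :: "'e topology"
    and T :: "'e \<Rightarrow> 'a::{uniform_space, t2_space} set"
  assumes "T \<in> topspace E \<rightarrow> K_sets"
  shows "lower_semicontinuous_multi E T \<and> upper_semicontinuous_multi E T \<longleftrightarrow>
         continuous_map E (subtopology H_topology K_sets) T"
proof -
  have CB: "T x \<in> CB_sets" and K: "compact (T x)" if "x \<in> topspace E" for x
    using that assms K_sets_subset_CB_sets by (auto simp: K_sets_def)
  show ?thesis
  proof
    assume semicont: "lower_semicontinuous_multi E T \<and> upper_semicontinuous_multi E T"
    \<comment> \<open>Since \<open>T\<close> takes values in \<open>K_sets\<close>, continuity into
      the subtopology is continuity into \<open>H_topology\<close>; the preimage is shown to be a
      neighbourhood of each of its points.\<close>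
    have "openin E {x \<in> topspace E. T x \<in> \<G>}" if \<G>: "openin H_topology \<G>" for \<G>
    proof (subst openin_subopen, intro ballI)
      fix x assume "x \<in> {x \<in> topspace E. T x \<in> \<G>}"
      then have x: "x \<in> topspace E" "T x \<in> \<G>" by auto
      obtain U where U: "U \<in> entourages" "H_entourage U `` {T x} \<subseteq> \<G>"
        using openin_H_topologyE \<G> x(2) by blast
      obtain N where N: "openin E N" "x \<in> N"
        and near: "\<And>y. y \<in> N \<Longrightarrow> T x \<subseteq> U `` T y \<and> T y \<subseteq> U `` T x"
        using semicontinuous_imp_H_near[of E T x U] semicont x(1) K U(1) by blast
      have "N \<subseteq> {x \<in> topspace E. T x \<in> \<G>}"
      proof
        fix y assume y: "y \<in> N"
        then have "y \<in> topspace E" using N(1) openin_subset by blast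
        then show "y \<in> {x \<in> topspace E. T x \<in> \<G>}"
          using near[OF y] U(2) CB x(1) by (auto simp: H_entourage_def)
      qed
      with N show "\<exists>N. openin E N \<and> x \<in> N \<and> N \<subseteq> {x \<in> topspace E. T x \<in> \<G>}"
        by blast
    qed
    then have "continuous_map E H_topology T"
      using CB by (auto simp: continuous_map_def topspace_H_topology)
    then show "continuous_map E (subtopology H_topology K_sets) T"
      using assms by (auto simp: continuous_map_in_subtopology)
  next
    assume "continuous_map E (subtopology H_topology K_sets) T"
    then have cont: "continuous_map E H_topology T"
      by (simp add: continuous_map_in_subtopology)
    have "openin E (multi_preimage E T G)" if "open G" for G
    proof -
      \<comment> \<open>Lower semicontinuity concerns exactly the preimages of the hit sets, which
        are open in \<open>H_topology\<close>.\<close>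
      have "multi_preimage E T G = {x \<in> topspace E. T x \<in> {B \<in> CB_sets. B \<inter> G \<noteq> {}}}"
        using CB by (auto simp: multi_preimage_def)
      then show ?thesis
        using openin_continuous_map_preimage[OF cont openin_H_topology_hit[OF that]] by simp
    qed
    moreover have "openin E {x \<in> topspace E. T x \<subseteq> G}" if "open G" for G
    proof -
      \<comment> \<open>Compactness of \<open>T x\<close> upgrades plain inclusion to inclusion with
        a uniform margin, the condition known to be open in \<open>H_topology\<close>; the converse
        is reflexivity of entourages.\<close>
      have "T x \<subseteq> G \<longleftrightarrow> (\<exists>U\<in>entourages. U `` T x \<subseteq> G)" if "x \<in> topspace E" for x
      proof
        assume "T x \<subseteq> G"
        with K[OF that] \<open>open G\<close> obtain U where "U \<in> entourages" "U `` T x \<subseteq> G"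
          by (rule compact_subset_open_entourageE)
        then show "\<exists>U\<in>entourages. U `` T x \<subseteq> G" by blast
      qed (use entourages_refl in fast)
      then have "{x \<in> topspace E. T x \<subseteq> G}
          = {x \<in> topspace E. T x \<in> {B \<in> CB_sets. \<exists>U\<in>entourages. U `` B \<subseteq> G}}"
        using CB by auto
      then show ?thesis
        using openin_continuous_map_preimage[OF cont openin_H_topology_miss] by simp
    qed
    ultimately show "lower_semicontinuous_multi E T \<and> upper_semicontinuous_multi E T"
      by (simp add: lower_semicontinuous_multi_def upper_semicontinuous_multi_iff_open)
  qed
qed

end
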